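(* Let $\Gamma\subset\mathbb{P}^9$ be a set of thirteen general points. Then there exists a $3$-Veronese surface containing $\Gamma$.
   Context: Work over an algebraically closed field of characteristic $0$. A $3$-Veronese surface in $\mathbb{P}^9$ is the image of $\mathbb{P}^2$ under an embedding by the complete linear system of plane cubics (the degree $9$ del Pezzo surface). *)

theory Defs
  imports "HOL-Analysis.Analysis" "HOL-Computational_Algebra.Polynomial" "HOL-Library.Numeral_Type"
begin

definition alg_closed_field :: "'k::field itself \<Rightarrow> bool" where
  "alg_closed_field _ \<longleftrightarrow> (\<forall>p :: 'k poly. degree p > 0 \<longrightarrow> (\<exists>x. poly p x = 0))"

inductive poly_fun :: "(('i \<Rightarrow> 'k::comm_ring_1) \<Rightarrow> 'k) \<Rightarrow> bool" where
  const: "poly_fun (\<lambda>_. c)"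
| var: "poly_fun (\<lambda>x. x i)"
| add: "poly_fun f \<Longrightarrow> poly_fun g \<Longrightarrow> poly_fun (\<lambda>x. f x + g x)"
| mult: "poly_fun f \<Longrightarrow> poly_fun g \<Longrightarrow> poly_fun (\<lambda>x. f x * g x)"

definition cubic_monomials :: "'k::comm_ring_1 ^ 3 \<Rightarrow> 'k list" where
  "cubic_monomials x = (let a = x $ 0; b = x $ 1; c = x $ 2 in
     [a^3, a^2*b, a^2*c, a*b^2, a*b*c, a*c^2, b^3, b^2*c, b*c^2, c^3])"

definition cubic_veronese_map :: "'k::comm_ring_1 ^ 3 \<Rightarrow> 'k ^ 10" where
  "cubic_veronese_map x = (\<chi> j. cubic_monomials x ! nat (Rep_bit0 j))"

text \<open>A 3-Veronese surface in P^9: image of P^2 under the cubic Veronese map composed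
  with a projective automorphism (invertible 10x10 matrix M).  The point of P^9 with
  homogeneous coordinates v lies on it iff v is proportional to M (nu_3 x) for some x \<noteq> 0.\<close>
definition on_veronese_surface :: "'k::field ^ 10 ^ 10 \<Rightarrow> 'k ^ 10 \<Rightarrow> bool" where
  "on_veronese_surface M v \<longleftrightarrow>
     (\<exists>x :: 'k ^ 3. x \<noteq> 0 \<and> (\<exists>c. v = c *s (M *v cubic_veronese_map x)))"

end

theory Submission
  imports Defs
begin

text \<open>
  Quantifier elimination over an algebraically closed field shows that the set of configurations
  \<open>(M \<nu>\<^sub>3(x\<^sub>i))\<^sub>i\<close> with \<open>M\<close> invertible contains or misses the complement of a hypersurface, so it is
  enough to show that it is Zariski dense, and this holds if the parametrization
  \<open>(M, x) \<mapsto> (M \<nu>\<^sub>3(x\<^sub>i))\<^sub>i\<close> has surjective differential at one point. That point is \<open>M = 1\<close>,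
  \<open>x\<^sub>i = (1, z\<^sup>i, z\<^sup>4\<^sup>i)\<close> with \<open>z\<close> a primitive 13th root of unity. There the cyclic group of order 13
  acts diagonally and splits the problem into characters. The ten cubic monomials have distinct
  characters 0, 1, 2, 3, 4, 5, 6, 8, 9, 12, and surjectivity says that for every \<open>f\<close> the exponent
  vectors of the monomials with character in \<open>{7, 10, 11} - f\<close> are linearly independent.
\<close>

section \<open>Polynomial functions and polynomial families\<close>

lemma poly_fun_uminus: "poly_fun f \<Longrightarrow> poly_fun (\<lambda>x. - f x)"
  using poly_fun.mult[OF poly_fun.const[of "-1"], of f] by simp

lemma poly_fun_diff: "poly_fun f \<Longrightarrow> poly_fun g \<Longrightarrow> poly_fun (\<lambda>x. f x - g x)"
  using poly_fun.add[of f "\<lambda>x. - g x"] poly_fun_uminus[of g] by simp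

lemma poly_fun_sum: "(\<And>a. a \<in> A \<Longrightarrow> poly_fun (f a)) \<Longrightarrow> poly_fun (\<lambda>x. \<Sum>a\<in>A. f a x)"
  by (induction A rule: infinite_finite_induct) (auto intro: poly_fun.intros)

lemma poly_fun_prod: "(\<And>a. a \<in> A \<Longrightarrow> poly_fun (f a)) \<Longrightarrow> poly_fun (\<lambda>x. \<Prod>a\<in>A. f a x)"
  by (induction A rule: infinite_finite_induct) (auto intro: poly_fun.intros)

lemma poly_fun_power: "poly_fun f \<Longrightarrow> poly_fun (\<lambda>x. f x ^ n)"
  by (induction n) (auto intro: poly_fun.intros)

lemma poly_fun_comp:
  assumes "poly_fun f" and "\<And>i. poly_fun (g i)"
  shows "poly_fun (\<lambda>x. f (\<lambda>i. g i x))"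
  using assms(1) by induction (auto intro: poly_fun.intros assms(2))

lemma poly_fun_det:
  assumes "\<And>i j. poly_fun (\<lambda>v. A v $ i $ j)"
  shows "poly_fun (\<lambda>v. det (A v))"
  unfolding det_def
  by (intro poly_fun_sum poly_fun.mult poly_fun.const poly_fun_prod assms)

text \<open>A polynomial in one distinguished variable over the ring of polynomial functions of the
  parameters \<open>v\<close>. The uniform degree bound does not follow from the condition on single
  coefficients and keeps such families closed under evaluation-like finite sums.\<close>

definition poly_family :: "(('i \<Rightarrow> 'k::comm_ring_1) \<Rightarrow> 'k poly) \<Rightarrow> bool" where
  "poly_family p \<longleftrightarrow> (\<forall>n. poly_fun (\<lambda>v. coeff (p v) n)) \<and> (\<exists>N. \<forall>v. degree (p v) \<le> N)"

lemma poly_family_coeff: "poly_family p \<Longrightarrow> poly_fun (\<lambda>v. coeff (p v) n)"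
  by (simp add: poly_family_def)

lemma poly_family_const: "poly_family (\<lambda>_. p)"
  by (auto simp: poly_family_def intro: poly_fun.const)

lemma poly_family_monom:
  assumes "poly_fun f"
  shows "poly_family (\<lambda>v. monom (f v) n)"
  unfolding poly_family_def
proof (intro conjI allI exI[of _ n])
  show "poly_fun (\<lambda>v. coeff (monom (f v) n) m)" for m
    using assms by (cases "n = m") (auto intro: poly_fun.const)
qed (simp add: degree_monom_le)

lemma poly_family_add:
  assumes "poly_family p" "poly_family q"
  shows "poly_family (\<lambda>v. p v + q v)"
proof -
  obtain N M where "\<And>v. degree (p v) \<le> N" "\<And>v. degree (q v) \<le> M"
    using assms by (auto simp: poly_family_def)
  then have "degree (p v + q v) \<le> max N M" for v
    by (intro degree_add_le) (auto simp: le_max_iff_disj)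
  then show ?thesis
    using assms by (auto simp: poly_family_def intro: poly_fun.add)
qed

lemma poly_family_mult:
  assumes "poly_family p" "poly_family q"
  shows "poly_family (\<lambda>v. p v * q v)"
proof -
  obtain N M where "\<And>v. degree (p v) \<le> N" "\<And>v. degree (q v) \<le> M"
    using assms by (auto simp: poly_family_def)
  then have "degree (p v * q v) \<le> N + M" for v
    by (meson add_mono degree_mult_le order_trans)
  moreover have "poly_fun (\<lambda>v. coeff (p v * q v) n)" for n
    unfolding coeff_mult using assms
    by (intro poly_fun_sum poly_fun.mult) (auto simp: poly_family_def)
  ultimately show ?thesis
    by (auto simp: poly_family_def)
qed

lemma poly_family_diff:
  assumes "poly_family p" "poly_family q"
  shows "poly_family (\<lambda>v. p v - q v)"
  using poly_family_add[OF assms(1) poly_family_mult[OF poly_family_const[of "-1"] assms(2)]]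
  by simp

lemma poly_family_smult:
  assumes "poly_fun c" "poly_family p"
  shows "poly_family (\<lambda>v. smult (c v) (p v))"
  using poly_family_mult[OF poly_family_monom[OF assms(1), of 0] assms(2)]
  by (simp add: monom_0)

lemma poly_family_power: "poly_family p \<Longrightarrow> poly_family (\<lambda>v. p v ^ n)"
  by (induction n) (auto intro: poly_family_const poly_family_mult)

lemma poly_family_prod:
  "(\<And>a. a \<in> A \<Longrightarrow> poly_family (p a)) \<Longrightarrow> poly_family (\<lambda>v. \<Prod>a\<in>A. p a v)"
  by (induction A rule: infinite_finite_induct) (auto intro: poly_family_const poly_family_mult)

lemma poly_family_pCons:
  assumes "poly_fun c" "poly_family p"
  shows "poly_family (\<lambda>v. pCons (c v) (p v))"
proof -
  have "pCons (c v) (p v) = monom (c v) 0 + monom 1 1 * p v" for v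
    by (simp add: monom_0 monom_Suc)
  then show ?thesis
    by (simp add: poly_family_add poly_family_mult poly_family_monom assms poly_family_const)
qed

text \<open>Induction on the build-up of \<open>f\<close>. Constant families restrict
  \<open>f\<close> to a curve, other choices isolate one coordinate or expand \<open>f\<close> along
  all lines through a point.\<close>

lemma poly_fun_subst_family:
  assumes "poly_fun f" and "\<And>k. poly_family (q k)"
  shows "\<exists>p. poly_family p \<and> (\<forall>v a. f (\<lambda>k. poly (q k v) a) = poly (p v) a)"
  using assms(1)
proof induction
  case (const c)
  then show ?case by (intro exI[of _ "\<lambda>_. [:c:]"]) (auto intro: poly_family_const)
next
  case (var i)
  then show ?case by (intro exI[of _ "q i"]) (auto intro: assms(2))
next
  case (add f g)
  then obtain p p' where "poly_family p" "poly_family p'"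
    "\<And>v a. f (\<lambda>k. poly (q k v) a) = poly (p v) a"
    "\<And>v a. g (\<lambda>k. poly (q k v) a) = poly (p' v) a" by blast
  then show ?case by (intro exI[of _ "\<lambda>v. p v + p' v"]) (auto intro: poly_family_add)
next
  case (mult f g)
  then obtain p p' where "poly_family p" "poly_family p'"
    "\<And>v a. f (\<lambda>k. poly (q k v) a) = poly (p v) a"
    "\<And>v a. g (\<lambda>k. poly (q k v) a) = poly (p' v) a" by blast
  then show ?case by (intro exI[of _ "\<lambda>v. p v * p' v"]) (auto intro: poly_family_mult)
qed

lemma poly_fun_curve:
  assumes "poly_fun f"
  shows "\<exists>p. \<forall>t. f (\<lambda>k. poly (q k) t) = poly p t"
  using poly_fun_subst_family[OF assms, of "\<lambda>k _. q k"] poly_family_const by blast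

lemma poly_fun_update:
  assumes "poly_fun f"
  shows "\<exists>p. poly_family p \<and> (\<forall>v a. f (v(i := a)) = poly (p v) a)"
proof -
  \<comment> \<open>Coordinate \<open>i\<close> becomes the variable of the univariate polynomial;
    the other coordinates stay parameters.\<close>
  let ?q = "\<lambda>k v. if k = i then [:0, 1:] else [:v k:]"
  have "poly_family (?q k)" for k
    by (cases "k = i") (auto intro!: poly_family_const poly_family_pCons poly_fun.var)
  then obtain p where "poly_family p" "\<And>v a. f (\<lambda>k. poly (?q k v) a) = poly (p v) a"
    using poly_fun_subst_family[OF assms, of ?q] by blast
  moreover have "(\<lambda>k. poly (?q k v) a) = v(i := a)" for v :: "'a \<Rightarrow> 'b" and a
    by (simp add: fun_eq_iff)
  ultimately show ?thesis by metis
qed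

text \<open>Irreducibility of affine space, also in infinitely many coordinates: on the line that
  meets \<open>y\<close> at time 0 and \<open>z\<close> at time 1 both functions are nonzero
  univariate polynomials, and their product has a non-root because the field is infinite.\<close>

lemma poly_fun_mult_nonzero:
  fixes f g :: "('i \<Rightarrow> 'k::field_char_0) \<Rightarrow> 'k"
  assumes "poly_fun f" "poly_fun g" "f y \<noteq> 0" "g z \<noteq> 0"
  shows "\<exists>x. f x * g x \<noteq> 0"
proof -
  let ?l = "\<lambda>k. [:y k, z k - y k:]"
  obtain p where p: "\<And>t. f (\<lambda>k. poly (?l k) t) = poly p t"
    using poly_fun_curve[OF assms(1), of ?l] by blast
  obtain q where q: "\<And>t. g (\<lambda>k. poly (?l k) t) = poly q t"
    using poly_fun_curve[OF assms(2), of ?l] by blast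
  have "p \<noteq> 0" using p[of 0] assms(3) by auto
  moreover have "q \<noteq> 0" using q[of 1] assms(4) by auto
  ultimately have "p * q \<noteq> 0" by simp
  then obtain t where "poly (p * q) t \<noteq> 0"
    using poly_all_0_iff_0 by blast
  then show ?thesis using p q by (metis poly_mult)
qed

section \<open>Constructible sets\<close>

inductive constructible :: "('i \<Rightarrow> 'k::field_char_0) set \<Rightarrow> bool" where
  zeros: "poly_fun f \<Longrightarrow> constructible {v. f v = 0}"
| compl: "constructible S \<Longrightarrow> constructible (- S)"
| inter: "constructible S \<Longrightarrow> constructible T \<Longrightarrow> constructible (S \<inter> T)"

lemma constructible_UNIV: "constructible UNIV"
  using constructible.zeros[OF poly_fun.const[of 0]] by simp

lemma constructible_empty: "constructible {}"
  using constructible.compl[OF constructible_UNIV] by simp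

lemma constructible_union: "constructible S \<Longrightarrow> constructible T \<Longrightarrow> constructible (S \<union> T)"
  using constructible.compl[OF constructible.inter[OF constructible.compl constructible.compl], of S T]
  by simp

lemma constructible_UN:
  "finite A \<Longrightarrow> (\<And>a. a \<in> A \<Longrightarrow> constructible (S a)) \<Longrightarrow> constructible (\<Union>a\<in>A. S a)"
  by (induction A rule: finite_induct) (auto intro: constructible_empty constructible_union)

lemma constructible_INT:
  "finite A \<Longrightarrow> (\<And>a. a \<in> A \<Longrightarrow> constructible (S a)) \<Longrightarrow> constructible (\<Inter>a\<in>A. S a)"
  by (induction A rule: finite_induct) (auto intro: constructible_UNIV constructible.inter)

lemma constructible_nonzeros: "poly_fun f \<Longrightarrow> constructible {v. f v \<noteq> 0}"
  using constructible.compl[OF constructible.zeros, of f] by (simp add: Collect_neg_eq)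

lemma constructible_vimage:
  assumes "constructible S" and "\<And>i. poly_fun (g i)"
  shows "constructible {u. (\<lambda>i. g i u) \<in> S}"
  using assms(1)
proof induction
  case (zeros f)
  then show ?case using constructible.zeros[OF poly_fun_comp[OF zeros assms(2)]] by simp
next
  case (compl S)
  then show ?case using constructible.compl by (fastforce simp: Collect_neg_eq)
next
  case (inter S T)
  then show ?case using constructible.inter by (fastforce simp: Collect_conj_eq)
qed

text \<open>Since affine space is irreducible, two nonempty principal open sets meet. Complements
  exchange the two alternatives, and for an intersection the product of the two polynomials
  serves.\<close>

lemma constructible_dichotomy:
  assumes "constructible S"
  shows "\<exists>F. poly_fun F \<and> (\<exists>y. F y \<noteq> 0) \<and> ((\<forall>v. F v \<noteq> 0 \<longrightarrow> v \<in> S) \<or> (\<forall>v. F v \<noteq> 0 \<longrightarrow> v \<notin> S))"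
  using assms
proof induction
  case (zeros f)
  show ?case
  proof (cases "\<exists>y. f y \<noteq> 0")
    case True
    then show ?thesis using zeros by (intro exI[of _ f]) auto
  next
    case False
    then show ?thesis by (intro exI[of _ "\<lambda>_. 1"]) (auto intro: poly_fun.const)
  qed
next
  case (compl S)
  then show ?case by auto
next
  case (inter S T)
  then obtain F G where FG: "poly_fun F" "\<exists>y. F y \<noteq> 0" "poly_fun G" "\<exists>y. G y \<noteq> 0"
    "(\<forall>v. F v \<noteq> 0 \<longrightarrow> v \<in> S) \<or> (\<forall>v. F v \<noteq> 0 \<longrightarrow> v \<notin> S)"
    "(\<forall>v. G v \<noteq> 0 \<longrightarrow> v \<in> T) \<or> (\<forall>v. G v \<noteq> 0 \<longrightarrow> v \<notin> T)" by blast
  then have "\<exists>y. F y * G y \<noteq> 0" using poly_fun_mult_nonzero by blast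
  then show ?case using FG
    by (intro exI[of _ "\<lambda>v. F v * G v"]) (auto intro: poly_fun.mult)
qed

text \<open>Recording only the zero pattern of finitely many polynomials avoids disjunctive normal forms.\<close>

lemma constructible_pattern:
  assumes "constructible S"
  shows "\<exists>L. finite L \<and> (\<forall>f\<in>L. poly_fun f) \<and> (\<exists>B. \<forall>v. v \<in> S \<longleftrightarrow> {f\<in>L. f v = 0} \<in> B)"
  using assms
proof induction
  case (zeros f)
  have "v \<in> {v. f v = 0} \<longleftrightarrow> {h\<in>{f}. h v = 0} \<in> {{f}}" for v by auto
  then show ?case using zeros by (intro exI[of _ "{f}"] conjI exI[of _ "{{f}}"] allI) simp_all
next
  case (compl S)
  then obtain L B where L: "finite L" "\<forall>f\<in>L. poly_fun f"
    and S: "\<forall>v. v \<in> S \<longleftrightarrow> {f\<in>L. f v = 0} \<in> B" by (elim exE conjE) (rule that)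
  have "v \<in> - S \<longleftrightarrow> {f\<in>L. f v = 0} \<in> - B" for v using S by simp
  then show ?case using L by (intro exI[of _ L] conjI exI[of _ "- B"] allI)
next
  case (inter S T)
  from inter.IH(1) obtain L B where L: "finite L" "\<forall>f\<in>L. poly_fun f"
    and S: "\<forall>v. v \<in> S \<longleftrightarrow> {f\<in>L. f v = 0} \<in> B" by (elim exE conjE) (rule that)
  from inter.IH(2) obtain L' B' where L': "finite L'" "\<forall>f\<in>L'. poly_fun f"
    and T: "\<forall>v. v \<in> T \<longleftrightarrow> {f\<in>L'. f v = 0} \<in> B'" by (elim exE conjE) (rule that)
  have eq: "{f \<in> L \<union> L'. f v = 0} \<inter> L = {f\<in>L. f v = 0}"
    "{f \<in> L \<union> L'. f v = 0} \<inter> L' = {f\<in>L'. f v = 0}" for v :: "'a \<Rightarrow> 'b"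
    by auto
  have "v \<in> S \<inter> T \<longleftrightarrow> {f\<in>L \<union> L'. f v = 0} \<in> {Z. Z \<inter> L \<in> B \<and> Z \<inter> L' \<in> B'}" for v
    by (simp only: Int_iff S[rule_format] T[rule_format] mem_Collect_eq eq)
  moreover have "finite (L \<union> L')" "\<forall>f\<in>L \<union> L'. poly_fun f" using L L' by auto
  ultimately show ?case by (intro exI[of _ "L \<union> L'"] conjI exI allI)
qed

section \<open>Quantifier elimination\<close>

text \<open>A one-variable Nullstellensatz with explicit exponent: split off the roots of
  \<open>p\<close> one at a time and let each linear factor divide its own copy of
  \<open>q\<close>.\<close>

lemma dvd_power_degree:
  fixes p q :: "'k::field poly"
  assumes "alg_closed_field TYPE('k)" "p \<noteq> 0" "\<And>a. poly p a = 0 \<Longrightarrow> poly q a = 0"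
  shows "p dvd q ^ degree p"
  using assms(2,3)
proof (induction "degree p" arbitrary: p)
  case 0
  then have "is_unit p" by (simp add: is_unit_iff_degree)
  then show ?case by (rule unit_imp_dvd)
next
  case (Suc d)
  then obtain a where a: "poly p a = 0"
    using assms(1) unfolding alg_closed_field_def by (metis zero_less_Suc)
  then obtain p' where p': "p = [:-a, 1:] * p'"
    by (auto simp: poly_eq_0_iff_dvd)
  with Suc have "p' \<noteq> 0" by auto
  then have "degree p = Suc (degree p')"
    unfolding p' by (subst degree_mult_eq) auto
  with Suc.hyps(2) have d: "d = degree p'" by simp
  have "p' dvd q ^ d"
    unfolding d using \<open>p' \<noteq> 0\<close> Suc.prems(2)
    by (intro Suc.hyps(1)[OF d]) (auto simp: p')
  moreover have "[:-a, 1:] dvd q" using Suc.prems(2)[OF a] by (simp add: poly_eq_0_iff_dvd)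
  ultimately have "[:-a, 1:] * p' dvd q * q ^ d" by (intro mult_dvd_mono)
  then show ?case unfolding Suc.hyps(2)[symmetric] p'[symmetric] by simp
qed

text \<open>This trades the existential quantifier over \<open>a\<close> for a divisibility, which
  can be tested by division on coefficients.\<close>

lemma ex_root_iff_not_dvd:
  fixes p q :: "'k::field poly"
  assumes "alg_closed_field TYPE('k)" "p \<noteq> 0"
  shows "(\<exists>a. poly p a = 0 \<and> poly q a \<noteq> 0) \<longleftrightarrow> \<not> p dvd q ^ degree p"
proof
  assume "\<exists>a. poly p a = 0 \<and> poly q a \<noteq> 0"
  then obtain a where a: "poly p a = 0" "poly q a \<noteq> 0" by blast
  show "\<not> p dvd q ^ degree p"
  proof
    assume "p dvd q ^ degree p"
    then obtain r where "q ^ degree p = p * r" by (rule dvdE)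
    then have "poly q a ^ degree p = poly p a * poly r a"
      by (metis poly_mult poly_power)
    with a show False by simp
  qed
next
  show "\<not> p dvd q ^ degree p \<Longrightarrow> \<exists>a. poly p a = 0 \<and> poly q a \<noteq> 0"
    using dvd_power_degree[OF assms] by blast
qed

text \<open>The bound is strict, so \<open>n = 0\<close> forces the zero polynomial. It is formal:
  the coefficient at \<open>n - 1\<close> may vanish for some parameters, and case splits on it
  drive the elimination.\<close>

definition bounded_family :: "(('i \<Rightarrow> 'k::comm_ring_1) \<Rightarrow> 'k poly) \<Rightarrow> nat \<Rightarrow> bool" where
  "bounded_family p n \<longleftrightarrow> poly_family p \<and> (\<forall>v m. m \<ge> n \<longrightarrow> coeff (p v) m = 0)"

lemma poly_family_bounded:
  assumes "poly_family p"
  shows "\<exists>n. bounded_family p n"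
proof -
  obtain N where "\<And>v. degree (p v) \<le> N" using assms by (auto simp: poly_family_def)
  then have "coeff (p v) m = 0" if "m \<ge> Suc N" for v m
    using that by (intro coeff_eq_0) (meson Suc_le_lessD le_less_trans)
  with assms show ?thesis unfolding bounded_family_def by blast
qed

lemma bounded_family_0: "bounded_family p 0 \<Longrightarrow> p v = 0"
  by (auto simp: bounded_family_def intro: poly_eqI)

lemma bounded_family_drop:
  assumes "bounded_family p (Suc n)"
  shows "bounded_family (\<lambda>v. p v - monom (coeff (p v) n) n) n"
  using assms unfolding bounded_family_def
  by (auto intro!: poly_family_diff poly_family_monom poly_family_coeff simp: Suc_le_eq)

text \<open>One step of pseudo-division: cross-multiplying by the top coefficients cancels the term
  of degree \<open>m\<close> without dividing by a function of the parameters.\<close>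

lemma bounded_family_reduce:
  assumes "bounded_family p (Suc n)" "bounded_family q (Suc m)" "n \<le> m"
  shows "bounded_family (\<lambda>v. smult (coeff (p v) n) (q v) - monom (coeff (q v) m) (m - n) * p v) m"
    (is "bounded_family ?r m")
  unfolding bounded_family_def
proof (intro conjI allI impI)
  show "poly_family ?r" using assms unfolding bounded_family_def
    by (auto intro!: poly_family_diff poly_family_smult poly_family_mult poly_family_monom poly_family_coeff)
  show "coeff (?r v) k = 0" if "m \<le> k" for v k
  proof (cases "k = m")
    case True
    then show ?thesis using assms(3) by (simp add: coeff_monom_mult)
  next
    case False
    with that have "Suc m \<le> k" "Suc n \<le> k - (m - n)" using assms(3) by auto
    then show ?thesis using assms by (auto simp: bounded_family_def coeff_monom_mult)
  qed
qed

section \<open>Constructibility of vanishing, divisibility and solvability in one variable\<close>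

lemma constructible_family_zero:
  assumes "bounded_family q m"
  shows "constructible {v. q v = 0}"
proof -
  have "{v. q v = 0} = (\<Inter>k\<in>{..<m}. {v. coeff (q v) k = 0})"
    using assms by (auto simp: bounded_family_def poly_eq_iff) (metis lessThan_iff not_le)
  moreover have "constructible (\<Inter>k\<in>{..<m}. {v. coeff (q v) k = 0})"
    using assms by (intro constructible_INT constructible.zeros)
      (auto simp: bounded_family_def poly_family_def)
  ultimately show ?thesis by simp
qed

text \<open>Where the top coefficient of \<open>p\<close> is nonzero, pseudo-division lowers the
  bound of \<open>q\<close> without affecting divisibility. Once that bound is at most
  \<open>n\<close>, a multiple of \<open>p v\<close> can only be zero.\<close>

lemma constructible_dvd:
  assumes "bounded_family p (Suc n)" "bounded_family q m"
  shows "constructible {v. coeff (p v) n \<noteq> 0 \<and> p v dvd q v}"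
  using assms(2)
proof (induction m arbitrary: q)
  have C: "constructible {v. coeff (p v) n \<noteq> 0}"
    using assms(1) by (auto simp: bounded_family_def poly_family_def intro: constructible_nonzeros)
  have small: "constructible {v. coeff (p v) n \<noteq> 0 \<and> p v dvd q v}"
    if "bounded_family q m" "m \<le> n" for q m
  proof -
    have "p v dvd q v \<longleftrightarrow> q v = 0" if c: "coeff (p v) n \<noteq> 0" for v
    proof
      assume dvd: "p v dvd q v"
      show "q v = 0"
      proof (rule ccontr)
        assume "q v \<noteq> 0"
        with dvd have "degree (p v) \<le> degree (q v)" by (rule dvd_imp_degree_le)
        then have "n \<le> degree (q v)" using c le_degree order_trans by blast
        then have "lead_coeff (q v) = 0"
          using \<open>bounded_family q m\<close> \<open>m \<le> n\<close> by (auto simp: bounded_family_def)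
        with \<open>q v \<noteq> 0\<close> show False by simp
      qed
    qed simp
    then have "{v. coeff (p v) n \<noteq> 0 \<and> p v dvd q v} = {v. coeff (p v) n \<noteq> 0} \<inter> {v. q v = 0}"
      by auto
    then show ?thesis
      using constructible.inter[OF C constructible_family_zero[OF \<open>bounded_family q m\<close>]] by simp
  qed
  {
    case 0
    then show ?case using small[OF 0] by simp
  next
    case (Suc m)
    show ?case
    proof (cases "Suc m \<le> n")
      case True
      then show ?thesis using small Suc by blast
    next
      case False
      let ?r = "\<lambda>v. smult (coeff (p v) n) (q v) - monom (coeff (q v) m) (m - n) * p v"
      \<comment> \<open>The scalar is a unit, and the subtracted term is a multiple of
        \<open>p v\<close>.\<close>
      have "p v dvd ?r v \<longleftrightarrow> p v dvd q v" if "coeff (p v) n \<noteq> 0" for v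
        using that by (simp add: dvd_diff_left_iff dvd_smult_iff)
      then have "{v. coeff (p v) n \<noteq> 0 \<and> p v dvd ?r v} = {v. coeff (p v) n \<noteq> 0 \<and> p v dvd q v}"
        by auto
      then show ?thesis
        using Suc.IH[OF bounded_family_reduce[OF assms(1) Suc.prems]] False by simp
    qed
  }
qed

text \<open>Induction on the degree bound: where the top coefficient vanishes it is dropped,
  elsewhere the root condition is a failure of divisibility.\<close>

lemma constructible_ex_one:
  fixes p q :: "('i \<Rightarrow> 'k::field_char_0) \<Rightarrow> 'k poly"
  assumes "alg_closed_field TYPE('k)" "bounded_family p n" "poly_family q"
  shows "constructible {v. \<exists>a. poly (p v) a = 0 \<and> poly (q v) a \<noteq> 0}"
  using assms(2)
proof (induction n arbitrary: p)
  case 0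
  \<comment> \<open>Here \<open>p\<close> is identically zero, and over an infinite field only the
    zero polynomial vanishes everywhere.\<close>
  have "{v. \<exists>a. poly (p v) a = 0 \<and> poly (q v) a \<noteq> 0} = - {v. q v = 0}"
    using poly_all_0_iff_0 by (auto simp: bounded_family_0[OF 0])
  then show ?case
    using poly_family_bounded[OF assms(3)] constructible_family_zero constructible.compl by metis
next
  case (Suc n)
  let ?r = "\<lambda>v. p v - monom (coeff (p v) n) n"
  let ?C = "{v. coeff (p v) n = 0}"
  have C: "constructible ?C"
    using Suc.prems by (auto simp: bounded_family_def poly_family_def intro: constructible.zeros)
  \<comment> \<open>The exponent can be the fixed number \<open>n\<close>, the degree of
    \<open>p v\<close> wherever its coefficient at \<open>n\<close> is nonzero; this makes the power
    a single polynomial family.\<close>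
  obtain m where m: "bounded_family (\<lambda>v. q v ^ n) m"
    using poly_family_bounded[OF poly_family_power[OF assms(3)]] by blast
  have iff: "(\<exists>a. poly (p v) a = 0 \<and> poly (q v) a \<noteq> 0) \<longleftrightarrow> \<not> p v dvd q v ^ n"
    if "coeff (p v) n \<noteq> 0" for v
  proof -
    have "degree (p v) \<le> n"
      by (rule degree_le) (use Suc.prems in \<open>auto simp: bounded_family_def\<close>)
    with that have "degree (p v) = n" using le_degree by fastforce
    moreover have "p v \<noteq> 0" using that by auto
    ultimately show ?thesis using ex_root_iff_not_dvd[OF assms(1)] by metis
  qed
  have "{v. \<exists>a. poly (p v) a = 0 \<and> poly (q v) a \<noteq> 0}
      = (?C \<inter> {v. \<exists>a. poly (?r v) a = 0 \<and> poly (q v) a \<noteq> 0})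
        \<union> (- ?C \<inter> - {v. coeff (p v) n \<noteq> 0 \<and> p v dvd q v ^ n})"
    using iff by auto
  also have "constructible \<dots>"
    by (intro constructible_union constructible.inter C constructible.compl
        Suc.IH[OF bounded_family_drop[OF Suc.prems]] constructible_dvd[OF Suc.prems m])
  finally show ?case .
qed

text \<open>The numbers in the list are degree bounds; their sum drops under pseudo-division.\<close>

definition elim_set :: "((('i \<Rightarrow> 'k::field) \<Rightarrow> 'k poly) \<times> nat) list \<Rightarrow> (('i \<Rightarrow> 'k) \<Rightarrow> 'k poly) \<Rightarrow> ('i \<Rightarrow> 'k) set" where
  "elim_set ps q = {v. \<exists>a. (\<forall>(p, n) \<in> set ps. poly (p v) a = 0) \<and> poly (q v) a \<noteq> 0}"

text \<open>A Euclidean algorithm with parameters reduces several equations to at most one. The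
  measure counts \<open>Suc n\<close> per equation, so that discarding an equation with bound 0 also
  lowers it.\<close>

lemma constructible_elim_set:
  fixes q :: "('i \<Rightarrow> 'k::field_char_0) \<Rightarrow> 'k poly"
  assumes "alg_closed_field TYPE('k)" "\<And>p n. (p, n) \<in> set ps \<Longrightarrow> bounded_family p n" "poly_family q"
  shows "constructible (elim_set ps q)"
  using assms(2)
proof (induction "\<Sum>(p, n)\<leftarrow>ps. Suc n" arbitrary: ps rule: less_induct)
  case (less ps)
  have two: "constructible (elim_set ((p1, n1) # (p2, n2) # rest) q)"
    if le: "n1 \<le> n2" and bd: "\<And>p n. (p, n) \<in> set ((p1, n1) # (p2, n2) # rest) \<Longrightarrow> bounded_family p n"
      and sum: "(\<Sum>(p, n)\<leftarrow>((p1, n1) # (p2, n2) # rest). Suc n) = (\<Sum>(p, n)\<leftarrow>ps. Suc n)"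
    for p1 n1 p2 n2 rest
  proof (cases n1)
    case 0
    then have "p1 v = 0" for v using bd[of p1 n1] bounded_family_0 by auto
    then have "elim_set ((p1, n1) # (p2, n2) # rest) q = elim_set ((p2, n2) # rest) q"
      by (auto simp: elim_set_def)
    then show ?thesis using less.hyps[of "(p2, n2) # rest"] bd sum by fastforce
  next
    case (Suc k)
    then obtain m where m: "n2 = Suc m" using le by (cases n2) auto
    have b1: "bounded_family p1 (Suc k)" using bd[of p1 n1] Suc by simp
    have b2: "bounded_family p2 (Suc m)" using bd[of p2 n2] m by simp
    let ?C = "{v. coeff (p1 v) k = 0}"
    let ?d = "\<lambda>v. p1 v - monom (coeff (p1 v) k) k"
    let ?r = "\<lambda>v. smult (coeff (p1 v) k) (p2 v) - monom (coeff (p2 v) m) (m - k) * p1 v"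
    have C: "constructible ?C"
      using b1 by (auto simp: bounded_family_def poly_family_def intro: constructible.zeros)
    \<comment> \<open>On \<open>?C\<close> the truncation does not change \<open>p1\<close>. Off
      \<open>?C\<close> the top coefficient of \<open>p1\<close> is invertible, so
      \<open>p1, p2\<close> and \<open>p1, ?r\<close> have the same common roots.\<close>
    have "elim_set ((p1, n1) # (p2, n2) # rest) q
        = (?C \<inter> elim_set ((?d, k) # (p2, n2) # rest) q) \<union> (- ?C \<inter> elim_set ((p1, n1) # (?r, m) # rest) q)"
      unfolding elim_set_def by auto
    moreover have "constructible (elim_set ((?d, k) # (p2, n2) # rest) q)"
      using bounded_family_drop[OF b1] bd sum Suc by (intro less.hyps) auto
    moreover have "constructible (elim_set ((p1, n1) # (?r, m) # rest) q)"
      using bounded_family_reduce[OF b1 b2] bd sum Suc m le by (intro less.hyps) auto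
    ultimately show ?thesis
      by (auto intro!: constructible_union constructible.inter constructible.compl C)
  qed
  consider "ps = []" | p n where "ps = [(p, n)]"
    | p1 n1 p2 n2 rest where "ps = (p1, n1) # (p2, n2) # rest"
    by (metis list.exhaust surj_pair)
  then show ?case
  proof cases
    case 1
    \<comment> \<open>The empty system is treated as the single equation 0 = 0.\<close>
    then have "elim_set ps q = {v. \<exists>a. poly 0 a = 0 \<and> poly (q v) a \<noteq> 0}"
      by (simp add: elim_set_def)
    moreover have "bounded_family (\<lambda>_. 0) 0"
      by (simp add: bounded_family_def poly_family_const)
    ultimately show ?thesis using constructible_ex_one[OF assms(1) _ assms(3)] by fastforce
  next
    case 2
    then show ?thesis using constructible_ex_one[OF assms(1) less.prems assms(3), of p n]
      by (simp add: elim_set_def)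
  next
    case 3
    show ?thesis
    proof (cases "n1 \<le> n2")
      case True
      then show ?thesis using two[of n1 n2 p1 p2 rest] 3 less.prems by simp
    next
      case False
      have "elim_set ps q = elim_set ((p2, n2) # (p1, n1) # rest) q"
        using 3 by (auto simp: elim_set_def)
      then show ?thesis using two[of n2 n1 p2 p1 rest] False 3 less.prems by auto
    qed
  qed
qed

text \<open>The set is a finite union over the zero patterns \<open>Z\<close> in \<open>B\<close>. A
  single pattern is a system of equations together with one inequation, which
  \<open>constructible_elim_set\<close> handles.\<close>

lemma constructible_ex_update:
  fixes S :: "('i \<Rightarrow> 'k::field_char_0) set"
  assumes "alg_closed_field TYPE('k)" "constructible S"
  shows "constructible {v. \<exists>a. v(i := a) \<in> S}"
proof -
  obtain L B where L: "finite L" "\<forall>f\<in>L. poly_fun f" and S: "\<forall>v. v \<in> S \<longleftrightarrow> {f\<in>L. f v = 0} \<in> B"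
    using constructible_pattern[OF assms(2)] by (elim exE conjE) (rule that)
  define fam where "fam f = (SOME p. poly_family p \<and> (\<forall>v a. f (v(i := a)) = poly (p v) a))"
    for f :: "('i \<Rightarrow> 'k) \<Rightarrow> 'k"
  have fam: "poly_family (fam f)" "f (v(i := a)) = poly (fam f v) a" if "f \<in> L" for f v a
    using someI_ex[OF poly_fun_update, of f i] L that unfolding fam_def by blast+
  have piece: "constructible {v. \<exists>a. {f\<in>L. f (v(i := a)) = 0} = Z}" if Z: "Z \<subseteq> L" for Z
  proof -
    obtain fs where fs: "set fs = Z" using finite_list finite_subset[OF Z L(1)] by blast
    define bd where "bd f = (SOME n. bounded_family (fam f) n)" for f
    have bd: "bounded_family (fam f) (bd f)" if "f \<in> L" for f
      using someI_ex[OF poly_family_bounded[OF fam(1)[OF that]]] by (simp add: bd_def)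
    define ps where "ps = map (\<lambda>f. (fam f, bd f)) fs"
    \<comment> \<open>All functions outside \<open>Z\<close> are nonzero exactly when their product
      is, so one inequation suffices.\<close>
    define q where "q v = (\<Prod>f\<in>L - Z. fam f v)" for v
    have "poly_family q" unfolding q_def[abs_def] by (intro poly_family_prod) (auto intro: fam)
    moreover have "bounded_family p n" if "(p, n) \<in> set ps" for p n
      using that fs Z bd by (auto simp: ps_def)
    ultimately have "constructible (elim_set ps q)"
      using constructible_elim_set[OF assms(1)] by blast
    moreover have "elim_set ps q = {v. \<exists>a. {f\<in>L. f (v(i := a)) = 0} = Z}"
    proof -
      have "(\<forall>(p, n)\<in>set ps. poly (p v) a = 0) \<longleftrightarrow> (\<forall>f\<in>Z. f (v(i := a)) = 0)" for v a
      proof -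
        have "f (v(i := a)) = poly (fam f v) a" if "f \<in> Z" for f
          using fam(2) Z that by blast
        then show ?thesis by (auto simp: ps_def simp flip: fs)
      qed
      moreover have "poly (q v) a \<noteq> 0 \<longleftrightarrow> (\<forall>f\<in>L - Z. f (v(i := a)) \<noteq> 0)" for v a
        using L(1) fam(2) by (auto simp: q_def poly_prod)
      ultimately show ?thesis using Z by (auto simp: elim_set_def)
    qed
    ultimately show ?thesis by simp
  qed
  have "{f\<in>L. f (v(i := a)) = 0} \<in> Pow L" for v a by blast
  then have "{v. \<exists>a. v(i := a) \<in> S} = (\<Union>Z\<in>Pow L \<inter> B. {v. \<exists>a. {f\<in>L. f (v(i := a)) = 0} = Z})"
    unfolding S[rule_format] by blast
  also have "constructible \<dots>"
    using L(1) by (intro constructible_UN piece) auto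
  finally show ?thesis .
qed

lemma constructible_ex_finite:
  fixes S :: "('i \<Rightarrow> 'k::field_char_0) set"
  assumes "alg_closed_field TYPE('k)" "finite B" "constructible S"
  shows "constructible {v. \<exists>w. override_on v w B \<in> S}"
  using assms(2)
proof (induction B rule: finite_induct)
  case empty
  then show ?case using assms(3) by simp
next
  case (insert b B)
  have "{v. \<exists>w. override_on v w (insert b B) \<in> S} = {v. \<exists>a. v(b := a) \<in> {v. \<exists>w. override_on v w B \<in> S}}"
  proof (intro Collect_cong iffI; clarsimp)
    fix v w
    assume "override_on v w (insert b B) \<in> S"
    moreover have "override_on v w (insert b B) = override_on (v(b := w b)) w B"
      using insert.hyps by (auto simp: override_on_def)
    ultimately show "\<exists>a w. override_on (v(b := a)) w B \<in> S" by metis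
  next
    fix v a w
    assume "override_on (v(b := a)) w B \<in> S"
    moreover have "override_on (v(b := a)) w B = override_on v (w(b := a)) (insert b B)"
      using insert.hyps by (auto simp: override_on_def)
    ultimately show "\<exists>w. override_on v w (insert b B) \<in> S" by metis
  qed
  then show ?case using constructible_ex_update[OF assms(1) insert.IH, of b] by simp
qed

text \<open>Chevalley's theorem for a coordinate projection that forgets finitely many
  coordinates.\<close>

lemma constructible_projection:
  fixes T :: "('a + 'b::finite \<Rightarrow> 'k::field_char_0) set"
  assumes "alg_closed_field TYPE('k)" "constructible T"
  shows "constructible {u. \<exists>w. case_sum u w \<in> T}"
proof -
  have "constructible {v. \<exists>w. override_on v w (range Inr) \<in> T}"
    by (intro constructible_ex_finite assms) simp
  \<comment> \<open>The zeros are placeholders: \<open>override_on\<close> replaces them on all of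
    \<open>range Inr\<close>.\<close>
  moreover have "poly_fun (\<lambda>u. case_sum u (\<lambda>_. 0) i)" for i :: "'a + 'b"
    by (cases i) (auto intro: poly_fun.intros)
  ultimately have "constructible {u. \<exists>w. override_on (case_sum u (\<lambda>_. 0)) w (range Inr) \<in> T}"
    using constructible_vimage[of _ "\<lambda>i u. case_sum u (\<lambda>_. 0) i"] by fastforce
  moreover have "(\<exists>w. override_on (case_sum u (\<lambda>_. 0)) w (range Inr) \<in> T) \<longleftrightarrow> (\<exists>w. case_sum u w \<in> T)" for u
  proof -
    have "override_on (case_sum u (\<lambda>_. 0)) w (range Inr) = case_sum u (w \<circ> Inr)" for w :: "'a + 'b \<Rightarrow> 'k"
      by (auto simp: override_on_def fun_eq_iff split: sum.split)
    moreover have "case_sum u w = case_sum u ((case_sum u w) \<circ> Inr)" for w :: "'b \<Rightarrow> 'k"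
      by (auto simp: fun_eq_iff split: sum.split)
    ultimately show ?thesis by metis
  qed
  ultimately show ?thesis by simp
qed

section \<open>Zariski density from tangent directions\<close>

text \<open>The lowest homogeneous part of the Taylor expansion of \<open>G\<close> at \<open>y\<close> vanishes at the tangent
  vector of each curve through \<open>y\<close> along which \<open>G\<close> vanishes.\<close>

lemma dense_if_curves:
  fixes G :: "('n \<Rightarrow> 'k::field_char_0) \<Rightarrow> 'k"
  assumes "poly_fun G"
    and curves: "\<And>\<zeta>. \<exists>P. (\<forall>k. coeff (P k) 0 = y k \<and> coeff (P k) 1 = \<zeta> k)
                     \<and> finite {t. G (\<lambda>k. poly (P k) t) \<noteq> 0}"
  shows "G x = 0"
proof (rule ccontr)
  assume "G x \<noteq> 0"
  \<comment> \<open>The family \<open>p\<close> obtained from these lines satisfies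
    \<open>G (y + s z) = poly (p z) s\<close>, so the coefficient at \<open>n\<close> is the
    homogeneous part of degree \<open>n\<close> of the Taylor expansion at \<open>y\<close>,
    evaluated at \<open>z\<close>.\<close>
  let ?q = "\<lambda>k z. [:y k, z k:]"
  have "poly_family (?q k)" for k
    by (intro poly_family_pCons poly_fun.const poly_fun.var poly_family_const)
  then obtain p where p: "poly_family p" "\<And>z s. G (\<lambda>k. poly (?q k z) s) = poly (p z) s"
    using poly_fun_subst_family[OF assms(1), of ?q] by blast
  obtain N where N: "\<And>z. degree (p z) \<le> N"
    using p(1) by (auto simp: poly_family_def)
  have "poly (p (\<lambda>k. x k - y k)) 1 = G x"
    using p(2)[of "\<lambda>k. x k - y k" 1] by simp
  with \<open>G x \<noteq> 0\<close> have "p (\<lambda>k. x k - y k) \<noteq> 0" by auto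
  then have ex: "\<exists>d. \<exists>z. coeff (p z) d \<noteq> 0"
    by (metis leading_coeff_0_iff)
  \<comment> \<open>The vanishing order of \<open>G\<close> at \<open>y\<close>; \<open>z\<close> is
    then a direction in which the lowest homogeneous part is nonzero.\<close>
  define d where "d = (LEAST d. \<exists>z. coeff (p z) d \<noteq> 0)"
  obtain z where z: "coeff (p z) d \<noteq> 0"
    using LeastI_ex[OF ex] by (auto simp: d_def)
  have low: "coeff (p z) n = 0" if "n < d" for n z
    using not_less_Least[of n "\<lambda>d. \<exists>z. coeff (p z) d \<noteq> 0"] that by (auto simp: d_def)
  obtain P where P: "\<And>k. coeff (P k) 0 = y k" "\<And>k. coeff (P k) 1 = z k"
    and fin: "finite {t. G (\<lambda>k. poly (P k) t) \<noteq> 0}"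
    using curves[of z] by blast
  \<comment> \<open>Writing the curve as \<open>y + t R(t)\<close> puts its point at time
    \<open>t\<close> on the line through \<open>y\<close> in direction \<open>R(t)\<close>, with
    \<open>R(0) = z\<close>.\<close>
  define R where "R k = poly_shift 1 (P k)" for k
  have PR: "P k = pCons (y k) (R k)" for k
    using P(1) by (intro poly_eqI) (auto simp: R_def coeff_poly_shift coeff_pCons split: nat.split)
  have R0: "poly (R k) 0 = z k" for k
    using P(2) by (simp add: R_def poly_0_coeff_0 coeff_poly_shift)
  have "\<exists>r. \<forall>t. coeff (p (\<lambda>k. poly (R k) t)) n = poly r t" for n
    using poly_fun_curve[OF poly_family_coeff[OF p(1)], where q = R and n1 = n] by blast
  then have "\<exists>r. \<forall>n t. coeff (p (\<lambda>k. poly (R k) t)) n = poly (r n) t"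
    by (intro choice allI)
  then obtain r :: "nat \<Rightarrow> 'k poly" where r: "\<And>n t. coeff (p (\<lambda>k. poly (R k) t)) n = poly (r n) t" by blast
  \<comment> \<open>The quotient of \<open>G\<close> along the curve by \<open>t ^ d\<close>. For
    \<open>n < d\<close> the truncated exponent is harmless, since \<open>r n\<close> vanishes at
    every \<open>t\<close>.\<close>
  define Q where "Q = (\<Sum>n\<le>N. monom 1 (n - d) * r n)"
  have val: "G (\<lambda>k. poly (P k) t) = t ^ d * poly Q t" for t
  proof -
    have "G (\<lambda>k. poly (P k) t) = poly (p (\<lambda>k. poly (R k) t)) t"
      using p(2)[of "\<lambda>k. poly (R k) t" t] by (simp add: PR)
    also have "\<dots> = (\<Sum>n\<le>N. coeff (p (\<lambda>k. poly (R k) t)) n * t ^ n)"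
      unfolding poly_altdef using N
      by (intro sum.mono_neutral_left) (auto simp: coeff_eq_0)
    also have "\<dots> = (\<Sum>n\<le>N. t ^ d * (t ^ (n - d) * poly (r n) t))"
    proof (rule sum.cong[OF refl])
      fix n
      show "coeff (p (\<lambda>k. poly (R k) t)) n * t ^ n = t ^ d * (t ^ (n - d) * poly (r n) t)"
      proof (cases "n < d")
        case True
        then show ?thesis using low r by (metis mult_zero_left mult_zero_right)
      next
        case False
        then have "t ^ n = t ^ d * t ^ (n - d)" by (simp flip: power_add)
        then show ?thesis using r by (simp add: mult_ac)
      qed
    qed
    also have "\<dots> = t ^ d * poly Q t"
      by (simp add: Q_def poly_sum poly_monom sum_distrib_left)
    finally show ?thesis .
  qed
  have "Q = 0"
  proof (rule ccontr)
    assume "Q \<noteq> 0"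
    then have "finite ({t. poly Q t = 0} \<union> {0} \<union> {t. G (\<lambda>k. poly (P k) t) \<noteq> 0})"
      using fin by (simp add: poly_roots_finite)
    moreover have "{t. poly Q t = 0} \<union> {0} \<union> {t. G (\<lambda>k. poly (P k) t) \<noteq> 0} = UNIV"
      using val by auto
    ultimately have "finite (UNIV :: 'k set)" by (simp only:)
    then show False using infinite_UNIV_char_0[where 'a = 'k] by blast
  qed
  \<comment> \<open>At \<open>t = 0\<close> only the term \<open>n = d\<close> survives, the lowest
    homogeneous part at \<open>z\<close>; it is nonzero, against \<open>Q = 0\<close>.\<close>
  moreover have "poly Q 0 = coeff (p z) d"
  proof -
    have "d \<le> N" using z N le_degree order_trans by blast
    have "poly Q 0 = (\<Sum>n\<le>N. 0 ^ (n - d) * poly (r n) 0)"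
      by (simp add: Q_def poly_sum poly_monom)
    also have "\<dots> = (\<Sum>n\<le>N. if n = d then coeff (p z) d else 0)"
    proof (rule sum.cong[OF refl])
      fix n
      show "0 ^ (n - d) * poly (r n) 0 = (if n = d then coeff (p z) d else 0)"
        using r[of 0 n] low[of n] by (auto simp: R0 power_0_left)
    qed
    finally show ?thesis using \<open>d \<le> N\<close> by simp
  qed
  ultimately show False using z by simp
qed

text \<open>Duality in finite dimension: a matrix whose transpose has trivial kernel has a right
  inverse.\<close>

lemma surj_if_annihilator_trivial:
  fixes L :: "'p::finite \<Rightarrow> 'n::finite \<Rightarrow> 'k::field"
  assumes "\<And>\<phi>. (\<And>a. (\<Sum>k\<in>UNIV. \<phi> k * L a k) = 0) \<Longrightarrow> \<forall>k. \<phi> k = 0"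
  shows "\<exists>c. \<forall>k. \<zeta> k = (\<Sum>a\<in>UNIV. c a * L a k)"
proof -
  define A :: "'k^'p^'n" where "A = (\<chi> k a. L a k)"
  have "x = 0" if "transpose A *v x = 0" for x
  proof -
    have "(\<Sum>k\<in>UNIV. x $ k * L a k) = 0" for a
      using that by (auto simp: vec_eq_iff matrix_vector_mult_def transpose_def A_def mult.commute)
    then show ?thesis using assms[of "\<lambda>k. x $ k"] by (simp add: vec_eq_iff)
  qed
  then have "\<exists>B. B ** transpose A = mat 1"
    by (simp add: matrix_left_invertible_ker)
  then have "surj ((*v) A)"
    by (simp add: left_invertible_transpose matrix_right_invertible_surjective)
  then obtain x where "(\<chi> k. \<zeta> k) = A *v x" by (meson surjD)
  then have "\<zeta> k = (\<Sum>a\<in>UNIV. x $ a * L a k)" for k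
    by (simp add: vec_eq_iff matrix_vector_mult_def A_def mult.commute)
  then show ?thesis by blast
qed

section \<open>Thirteen points with a cyclic symmetry\<close>

text \<open>A root of 1 + x + ... + x^12 has 13th power 1 and is not 1, as 13 is nonzero in
  characteristic 0. Since 13 is prime, a Bezout relation rules out any other order.\<close>

lemma ex_primitive_root_13:
  assumes "alg_closed_field TYPE('k::field_char_0)"
  shows "\<exists>z::'k. z ^ 13 = 1 \<and> (\<forall>k. z ^ k = 1 \<longrightarrow> 13 dvd k)"
proof -
  let ?p = "\<Sum>k<13. monom 1 k :: 'k poly"
  have "coeff ?p 12 = 1"
    by (simp add: coeff_sum)
  then have "degree ?p \<ge> 12" by (intro le_degree) simp
  then obtain z where "poly ?p z = 0"
    using assms unfolding alg_closed_field_def by (metis less_le_trans zero_less_numeral)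
  then have s: "(\<Sum>k<13. z ^ k) = 0" by (simp add: poly_sum poly_monom)
  have z13: "z ^ 13 = 1"
    using power_diff_1_eq[of z 13] s by simp
  have "z \<noteq> 1"
  proof
    assume "z = 1"
    with s show False by simp
  qed
  have "13 dvd k" if "z ^ k = 1" for k :: nat
  proof (rule ccontr)
    assume "\<not> 13 dvd k"
    moreover have "prime (13::nat)" by simp
    ultimately have "coprime k 13"
      using prime_imp_coprime coprime_commute by blast
    then obtain x y where xy: "k * x = 13 * y + 1"
      using coprime_bezout_strong[of k 13] by auto
    have "z = (z ^ 13) ^ y * z" by (simp add: z13)
    also have "\<dots> = z ^ (k * x)" by (simp add: xy power_mult power_add)
    also have "\<dots> = 1" by (simp add: power_mult that)
    finally show False using \<open>z \<noteq> 1\<close> by simp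
  qed
  with z13 show ?thesis by blast
qed

text \<open>Fourier inversion on the cyclic group of order 13; \<open>13 - n0\<close> replaces
  \<open>-n0\<close> to keep exponents natural.\<close>

lemma fourier_zero:
  fixes z :: "'k::field_char_0" and \<phi> :: "nat \<Rightarrow> 'k"
  assumes "z ^ 13 = 1" "\<And>k. z ^ k = 1 \<Longrightarrow> 13 dvd k"
    and "\<And>e. (\<Sum>n<13. \<phi> n * z ^ (n * e)) = 0" and "n0 < 13"
  shows "\<phi> n0 = 0"
proof -
  have geo: "(\<Sum>e<13. z ^ ((n + (13 - n0)) * e)) = (if n = n0 then 13 else 0)" if "n < 13" for n
  proof (cases "n = n0")
    case True
    then show ?thesis using assms(1,4) by (simp add: power_mult)
  next
    case False
    let ?w = "z ^ (n + (13 - n0))"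
    have "\<not> 13 dvd n + (13 - n0)"
    proof
      assume "13 dvd n + (13 - n0)"
      then obtain k where "n + (13 - n0) = 13 * k" by (rule dvdE)
      then have "k = 1" using that assms(4) by linarith
      with \<open>n + (13 - n0) = 13 * k\<close> False assms(4) show False by linarith
    qed
    then have "?w \<noteq> 1" using assms(2) by blast
    moreover have "?w ^ 13 = 1" by (metis assms(1) mult.commute power_mult power_one)
    ultimately have "(\<Sum>e<13. ?w ^ e) = 0"
      using power_diff_1_eq[of ?w 13] by simp
    with False show ?thesis by (simp add: power_mult)
  qed
  have "0 = (\<Sum>e<13. z ^ ((13 - n0) * e) * (\<Sum>n<13. \<phi> n * z ^ (n * e)))"
    by (simp only: assms(3) mult_zero_right sum.neutral_const)
  also have "\<dots> = (\<Sum>e<13. \<Sum>n<13. \<phi> n * z ^ ((n + (13 - n0)) * e))"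
    unfolding sum_distrib_left
    by (intro sum.cong refl) (simp add: add_mult_distrib power_add)
  also have "\<dots> = (\<Sum>n<13. \<Sum>e<13. \<phi> n * z ^ ((n + (13 - n0)) * e))"
    by (rule sum.swap)
  also have "\<dots> = (\<Sum>n<13. \<phi> n * (if n = n0 then 13 else 0))"
    using geo by (simp flip: sum_distrib_left)
  also have "\<dots> = 13 * \<phi> n0" using assms(4) by (simp add: if_distrib[of "(*) _"] cong: if_cong)
  finally show ?thesis by simp
qed

text \<open>Exponents of the three variables, listed in the order of
  \<open>cubic_monomials\<close>.\<close>

definition cubic_exp :: "3 \<Rightarrow> nat \<Rightarrow> nat" where
  "cubic_exp v m = (if v = 0 then [3,2,2,1,1,1,0,0,0,0]
     else if v = 1 then [0,1,0,2,1,0,3,2,1,0] else [0,0,1,0,1,2,0,1,2,3]) ! m"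

text \<open>The monomial with index \<open>m\<close> takes the value \<open>z ^ (n * character m)\<close> at \<open>(1, z ^ n, z ^ (4 * n))\<close>.\<close>

definition character :: "nat \<Rightarrow> nat" where
  "character m = cubic_exp 1 m + 4 * cubic_exp 2 m"

section \<open>Indexing and explicit values for the ten cubic monomials\<close>

lemma all_less_10: "(\<forall>m<10. P m) \<longleftrightarrow> P 0 \<and> P 1 \<and> P 2 \<and> P 3 \<and> P 4 \<and> P 5 \<and> P 6 \<and> P 7 \<and> P 8 \<and> P (9::nat)"
  by (auto simp: eval_nat_numeral All_less_Suc)

abbreviation idx :: "10 \<Rightarrow> nat" where "idx j \<equiv> nat (Rep_bit0 j)"

lemma Rep_10: "Rep_bit0 (j :: 10) \<in> {0..<10}"
  using Rep_bit0[of j] by simp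

lemma idx_less: "idx j < 10"
  using Rep_10[of j] by auto

lemma bij_idx: "bij_betw idx UNIV {..<10}"
proof -
  have "inj idx"
  proof (rule injI)
    fix i j assume "idx i = idx j"
    then have "Rep_bit0 i = Rep_bit0 j" using Rep_10[of i] Rep_10[of j] by auto
    then show "i = j" by (simp add: Rep_bit0_inject)
  qed
  moreover have "idx ` UNIV \<subseteq> {..<10}" using idx_less by auto
  ultimately show ?thesis
    by (simp add: bij_betw_def card_subset_eq card_image)
qed

lemma UNIV_index_3: "UNIV = {0, 1, 2 :: 3}"
  using UNIV_3 by auto

lemma three_distinct: "(0::3) \<noteq> 1" "(0::3) \<noteq> 2" "(1::3) \<noteq> 2" "(1::3) \<noteq> 0" "(2::3) \<noteq> 0" "(2::3) \<noteq> 1"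
  by simp_all

lemma prod_index_3: "(\<Prod>v\<in>UNIV. f (v::3)) = f 0 * f 1 * f 2"
  unfolding UNIV_index_3 by (simp add: mult.assoc)

lemma sum_index_3: "(\<Sum>v\<in>UNIV. f (v::3)) = f 0 + f 1 + f 2"
  unfolding UNIV_index_3 by (simp add: add.assoc)

lemma veronese_component:
  "cubic_veronese_map x $ j = (\<Prod>v\<in>UNIV. x $ v ^ cubic_exp v (idx j))"
proof -
  have "\<forall>m<10. cubic_monomials x ! m = (\<Prod>v\<in>UNIV. x $ v ^ cubic_exp v m)"
    unfolding all_less_10
    by (simp add: cubic_monomials_def Let_def prod_index_3 cubic_exp_def three_distinct mult_ac)
  then show ?thesis using idx_less by (simp add: cubic_veronese_map_def)
qed

lemma sum_less_10: "(\<Sum>m<10. f m) = f 0 + f 1 + f 2 + f 3 + f 4 + f 5 + f 6 + f 7 + f 8 + f (9::nat)"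
  by (simp add: eval_nat_numeral)

lemma all_less_13: "(\<forall>m<13. P m) \<longleftrightarrow> P 0 \<and> P 1 \<and> P 2 \<and> P 3 \<and> P 4 \<and> P 5 \<and> P 6 \<and> P 7 \<and> P 8 \<and> P 9 \<and> P 10 \<and> P 11 \<and> P (12::nat)"
  by (auto simp: eval_nat_numeral All_less_Suc)

lemma cubic_exp_simps:
  "cubic_exp 0 0 = 3" "cubic_exp 0 1 = 2" "cubic_exp 0 2 = 2" "cubic_exp 0 3 = 1" "cubic_exp 0 4 = 1" "cubic_exp 0 5 = 1" "cubic_exp 0 6 = 0" "cubic_exp 0 7 = 0" "cubic_exp 0 8 = 0" "cubic_exp 0 9 = 0"
  "cubic_exp 1 0 = 0" "cubic_exp 1 1 = 1" "cubic_exp 1 2 = 0" "cubic_exp 1 3 = 2" "cubic_exp 1 4 = 1" "cubic_exp 1 5 = 0" "cubic_exp 1 6 = 3" "cubic_exp 1 7 = 2" "cubic_exp 1 8 = 1" "cubic_exp 1 9 = 0"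
  "cubic_exp 2 0 = 0" "cubic_exp 2 1 = 0" "cubic_exp 2 2 = 1" "cubic_exp 2 3 = 0" "cubic_exp 2 4 = 1" "cubic_exp 2 5 = 2" "cubic_exp 2 6 = 0" "cubic_exp 2 7 = 1" "cubic_exp 2 8 = 2" "cubic_exp 2 9 = 3"
  by (simp_all add: cubic_exp_def three_distinct)

lemma character_simps:
  "character 0 = 0" "character 1 = 1" "character 2 = 4" "character 3 = 2" "character 4 = 5" "character 5 = 8" "character 6 = 3" "character 7 = 6" "character 8 = 9" "character 9 = 12"
  by (simp_all add: character_def cubic_exp_simps del: One_nat_def)

lemma cramer2:
  fixes x y :: "'k::field"
  assumes "a1 * x + b1 * y = 0" "a2 * x + b2 * y = 0" and "a1 * b2 - a2 * b1 \<noteq> 0"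
  shows "x = 0 \<and> y = 0"
proof -
  have "(a1 * b2 - a2 * b1) * x = b2 * (a1 * x + b1 * y) - b1 * (a2 * x + b2 * y)"
    "(a1 * b2 - a2 * b1) * y = a1 * (a2 * x + b2 * y) - a2 * (a1 * x + b1 * y)"
    by (simp_all add: algebra_simps)
  note this[unfolded assms(1,2)]
  with assms(3) show ?thesis by simp
qed

lemma cramer3:
  fixes x y w :: "'k::field"
  assumes "a1 * x + b1 * y + c1 * w = 0" "a2 * x + b2 * y + c2 * w = 0" "a3 * x + b3 * y + c3 * w = 0"
    and "a1 * (b2 * c3 - b3 * c2) - b1 * (a2 * c3 - a3 * c2) + c1 * (a2 * b3 - a3 * b2) \<noteq> 0" (is "?D \<noteq> 0")
  shows "x = 0 \<and> y = 0 \<and> w = 0"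
proof -
  let ?E1 = "a1 * x + b1 * y + c1 * w" and ?E2 = "a2 * x + b2 * y + c2 * w" and ?E3 = "a3 * x + b3 * y + c3 * w"
  have "?D * x = (b2 * c3 - b3 * c2) * ?E1 - (b1 * c3 - b3 * c1) * ?E2 + (b1 * c2 - b2 * c1) * ?E3"
    "?D * y = - (a2 * c3 - a3 * c2) * ?E1 + (a1 * c3 - a3 * c1) * ?E2 - (a1 * c2 - a2 * c1) * ?E3"
    "?D * w = (a2 * b3 - a3 * b2) * ?E1 - (a1 * b3 - a3 * b1) * ?E2 + (a1 * b2 - a2 * b1) * ?E3"
    by (simp_all add: algebra_simps)
  note this[unfolded assms(1-3)]
  with assms(4) show ?thesis by simp
qed

text \<open>For fixed \<open>f\<close> only the characters 7, 10, 11 survive in the second assumption. This leaves at most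
  three unknowns, whose coefficient columns are linearly independent exponent vectors.\<close>

lemma characters_independent:
  fixes H :: "nat \<Rightarrow> nat \<Rightarrow> 'k::field_char_0"
  assumes vanish: "\<And>m m'. m < 10 \<Longrightarrow> m' < 10 \<Longrightarrow> H m (character m') = 0"
    and eqs: "\<And>f v. f < 13 \<Longrightarrow> (\<Sum>m<10. of_nat (cubic_exp v m) * H m ((character m + f) mod 13)) = 0"
    and "m < 10" "e < 13"
  shows "H m e = 0"
proof -
  have z0: "H m 0 = 0" if "m < 10" for m using vanish[OF that, of 0, unfolded character_simps] by simp
  have z1: "H m 1 = 0" if "m < 10" for m using vanish[OF that, of 1, unfolded character_simps] by simp
  have z4: "H m 4 = 0" if "m < 10" for m using vanish[OF that, of 2, unfolded character_simps] by simp
  have z2: "H m 2 = 0" if "m < 10" for m using vanish[OF that, of 3, unfolded character_simps] by simp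
  have z5: "H m 5 = 0" if "m < 10" for m using vanish[OF that, of 4, unfolded character_simps] by simp
  have z8: "H m 8 = 0" if "m < 10" for m using vanish[OF that, of 5, unfolded character_simps] by simp
  have z3: "H m 3 = 0" if "m < 10" for m using vanish[OF that, of 6, unfolded character_simps] by simp
  have z6: "H m 6 = 0" if "m < 10" for m using vanish[OF that, of 7, unfolded character_simps] by simp
  have z9: "H m 9 = 0" if "m < 10" for m using vanish[OF that, of 8, unfolded character_simps] by simp
  have z12: "H m 12 = 0" if "m < 10" for m using vanish[OF that, of 9, unfolded character_simps] by simp
  note z = z0 z1 z2 z3 z4 z5 z6 z8 z9 z12 z1[simplified] z2[unfolded numeral_2_eq_2]
  note e = eqs[of _ 0, unfolded sum_less_10 cubic_exp_simps character_simps]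
     eqs[of _ 1, unfolded sum_less_10 cubic_exp_simps character_simps]
     eqs[of _ 2, unfolded sum_less_10 cubic_exp_simps character_simps]
  \<comment> \<open>For \<open>f = 0\<close> nothing survives, because 7, 10, 11 are exactly the
    missing characters. For \<open>f = 1\<close> the characters 6 and 9 move to 7 and 10, leaving
    \<open>b^2*c\<close> and \<open>b*c^2\<close> with exponent vectors (0,2,1) and (0,1,2). The
    other shifts are read off in the same way.\<close>
  have e1: "2 * H 7 7 + 1 * H 8 10 = 0"
    "1 * H 7 7 + 2 * H 8 10 = 0"
    using e[of 1] by (simp_all add: z add.assoc del: One_nat_def)
  have f1: "H 7 7 = 0" "H 8 10 = 0"
    using cramer2[OF e1] by simp_all
  have e2: "1 * H 4 7 + 1 * H 5 10 + 0 * H 8 11 = 0"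
    "1 * H 4 7 + 0 * H 5 10 + 1 * H 8 11 = 0"
    "1 * H 4 7 + 2 * H 5 10 + 2 * H 8 11 = 0"
    using e[of 2] by (simp_all add: z add.assoc del: One_nat_def)
  have f2: "H 4 7 = 0" "H 5 10 = 0" "H 8 11 = 0"
    using cramer3[OF e2] by simp_all
  have e3: "2 * H 2 7 + 1 * H 5 11 = 0"
    "1 * H 2 7 + 2 * H 5 11 = 0"
    using e[of 3] by (simp_all add: z add.assoc del: One_nat_def)
  have f3: "H 2 7 = 0" "H 5 11 = 0"
    using cramer2[OF e3] by simp_all
  have e4: "3 * H 6 7 + 2 * H 7 10 = 0"
    "0 * H 6 7 + 1 * H 7 10 = 0"
    using e[of 4] by (simp_all add: z add.assoc del: One_nat_def)
  have f4: "H 6 7 = 0" "H 7 10 = 0"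
    using cramer2[OF e4] by simp_all
  have e5: "1 * H 3 7 + 1 * H 4 10 + 0 * H 7 11 = 0"
    "2 * H 3 7 + 1 * H 4 10 + 2 * H 7 11 = 0"
    "0 * H 3 7 + 1 * H 4 10 + 1 * H 7 11 = 0"
    using e[of 5] by (simp_all add: z add.assoc del: One_nat_def)
  have f5: "H 3 7 = 0" "H 4 10 = 0" "H 7 11 = 0"
    using cramer3[OF e5] by simp_all
  have e6: "2 * H 1 7 + 2 * H 2 10 + 1 * H 4 11 = 0"
    "1 * H 1 7 + 0 * H 2 10 + 1 * H 4 11 = 0"
    "0 * H 1 7 + 1 * H 2 10 + 1 * H 4 11 = 0"
    using e[of 6] by (simp_all add: z add.assoc del: One_nat_def)
  have f6: "H 1 7 = 0" "H 2 10 = 0" "H 4 11 = 0"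
    using cramer3[OF e6] by simp_all
  have e7: "3 * H 0 7 + 2 * H 2 11 + 0 * H 6 10 = 0"
    "0 * H 0 7 + 0 * H 2 11 + 3 * H 6 10 = 0"
    "0 * H 0 7 + 1 * H 2 11 + 0 * H 6 10 = 0"
    using e[of 7] by (simp_all add: z add.assoc del: One_nat_def)
  have f7: "H 0 7 = 0" "H 2 11 = 0" "H 6 10 = 0"
    using cramer3[OF e7] by simp_all
  have e8: "1 * H 3 10 + 0 * H 6 11 + 0 * H 9 7 = 0"
    "2 * H 3 10 + 3 * H 6 11 + 0 * H 9 7 = 0"
    "0 * H 3 10 + 0 * H 6 11 + 3 * H 9 7 = 0"
    using e[of 8] by (simp_all add: z add.assoc del: One_nat_def)
  have f8: "H 3 10 = 0" "H 6 11 = 0" "H 9 7 = 0"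
    using cramer3[OF e8] by simp_all
  have e9: "2 * H 1 10 + 1 * H 3 11 = 0"
    "1 * H 1 10 + 2 * H 3 11 = 0"
    using e[of 9] by (simp_all add: z add.assoc del: One_nat_def)
  have f9: "H 1 10 = 0" "H 3 11 = 0"
    using cramer2[OF e9] by simp_all
  have e10: "3 * H 0 10 + 2 * H 1 11 = 0"
    "0 * H 0 10 + 1 * H 1 11 = 0"
    using e[of 10] by (simp_all add: z add.assoc del: One_nat_def)
  have f10: "H 0 10 = 0" "H 1 11 = 0"
    using cramer2[OF e10] by simp_all
  have e11: "3 * H 0 11 + 0 * H 8 7 + 0 * H 9 10 = 0"
    "0 * H 0 11 + 1 * H 8 7 + 0 * H 9 10 = 0"
    "0 * H 0 11 + 2 * H 8 7 + 3 * H 9 10 = 0"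
    using e[of 11] by (simp_all add: z add.assoc del: One_nat_def)
  have f11: "H 0 11 = 0" "H 8 7 = 0" "H 9 10 = 0"
    using cramer3[OF e11] by simp_all
  have e12: "1 * H 5 7 + 0 * H 9 11 = 0"
    "2 * H 5 7 + 3 * H 9 11 = 0"
    using e[of 12] by (simp_all add: z add.assoc del: One_nat_def)
  have f12: "H 5 7 = 0" "H 9 11 = 0"
    using cramer2[OF e12] by simp_all
  \<comment> \<open>Each pair of a monomial \<open>m\<close> and an \<open>e\<close> among 7, 10, 11
    occurred for exactly one shift, namely \<open>f = e - character m\<close> modulo 13.\<close>
  have "\<forall>m<10. \<forall>e<13. H m e = 0"
    unfolding all_less_10 all_less_13 by (simp add: z f1 f2 f3 f4 f5 f6 f7 f8 f9 f10 f11 f12 del: One_nat_def)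
  with assms(3,4) show ?thesis by blast
qed

text \<open>The right-hand side is the differential of the parametrization at the identity matrix
  and the points \<open>X\<close>: \<open>A\<close> moves the matrix, and \<open>W\<close> gives
  relative velocities of the coordinates, which turn the derivative of a monomial into an
  exponent-weighted sum. Surjectivity follows by showing that every annihilating functional is
  zero.\<close>

lemma tangent_map_surjective:
  assumes "alg_closed_field TYPE('k::field_char_0)"
  shows "\<exists>X :: 13 \<Rightarrow> 'k ^ 3. \<forall>\<zeta> :: 13 \<times> 10 \<Rightarrow> 'k. \<exists>(A :: 'k ^ 10 ^ 10) (W :: 13 \<Rightarrow> 3 \<Rightarrow> 'k). \<forall>i j.
    \<zeta> (i, j) = (\<Sum>b\<in>UNIV. A $ j $ b * cubic_veronese_map (X i) $ b)
      + (\<Sum>v\<in>UNIV. of_nat (cubic_exp v (idx j)) * W i v) * cubic_veronese_map (X i) $ j"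
proof -
  obtain z :: 'k where z: "z ^ 13 = 1" "\<And>k. z ^ k = 1 \<Longrightarrow> 13 dvd k"
    using ex_primitive_root_13[OF assms] by blast
  obtain pos :: "13 \<Rightarrow> nat" where pos: "bij_betw pos UNIV {..<13}"
    using ex_bij_betw_finite_nat[of "UNIV :: 13 set"] by (auto simp: lessThan_atLeast0)
  define X :: "13 \<Rightarrow> 'k ^ 3" where
    "X i = (\<chi> v. if v = 0 then 1 else if v = 1 then z ^ pos i else z ^ (4 * pos i))" for i
  have ver: "cubic_veronese_map (X i) $ j = z ^ (pos i * character (idx j))" for i j
    by (simp add: veronese_component prod_index_3 X_def three_distinct character_def
        power_add add_mult_distrib2 power_mult mult_ac flip: power_mult)
  \<comment> \<open>Images of the basis directions: \<open>Inl\<close> for the 100 matrix entries,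
    \<open>Inr\<close> for the 39 relative velocities of point coordinates.\<close>
  define L :: "((10 \<times> 10) + (13 \<times> 3)) \<Rightarrow> (13 \<times> 10) \<Rightarrow> 'k" where
    "L p k = (case p of
        Inl ab \<Rightarrow> if snd k = fst ab then cubic_veronese_map (X (fst k)) $ snd ab else 0
      | Inr iv \<Rightarrow> if fst k = fst iv
          then of_nat (cubic_exp (snd iv) (idx (snd k))) * cubic_veronese_map (X (fst k)) $ snd k else 0)" for p k
  have surj: "\<exists>c. \<forall>k. \<zeta> k = (\<Sum>p\<in>UNIV. c p * L p k)" for \<zeta>
  proof (rule surj_if_annihilator_trivial)
    fix \<phi> :: "13 \<times> 10 \<Rightarrow> 'k"
    assume ann: "\<And>p. (\<Sum>k\<in>UNIV. \<phi> k * L p k) = 0"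
    define ix where "ix = inv_into UNIV idx"
    have ix: "idx (ix m) = m" if "m < 10" for m
      using that bij_idx unfolding ix_def by (auto intro!: f_inv_into_f simp: bij_betw_def)
    have ix': "ix (idx j) = j" for j
      using bij_idx unfolding ix_def by (auto intro!: inv_into_f_f simp: bij_betw_def)
    \<comment> \<open>The Fourier transform over the thirteen points of the part of \<phi> belonging
      to monomial \<open>m\<close>.\<close>
    define H where "H m e = (\<Sum>i\<in>UNIV. \<phi> (i, ix m) * z ^ (pos i * e))" for m e
    have H_mod: "H m (e mod 13) = H m e" for m e
    proof -
      have "z ^ (n * e) = z ^ (n * (e mod 13))" for n
      proof -
        have "n * e = n * (e mod 13) + 13 * (n * (e div 13))"
          by (metis add_mult_distrib2 mod_mult_div_eq mult.left_commute)
        then show ?thesis using z(1) by (simp add: power_add power_mult)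
      qed
      then show ?thesis by (simp add: H_def)
    qed
    \<comment> \<open>Annihilation of the matrix directions.\<close>
    have H0: "H m (character m') = 0" if "m < 10" "m' < 10" for m m'
    proof -
      have "0 = (\<Sum>i\<in>UNIV. \<Sum>j\<in>UNIV. \<phi> (i, j) * L (Inl (ix m, ix m')) (i, j))"
        using ann[of "Inl (ix m, ix m')"] by (simp add: sum.cartesian_product)
      also have "\<dots> = H m (character m')"
        unfolding H_def by (intro sum.cong refl) (simp add: L_def ver ix that if_distrib[of "(*) _"] cong: if_cong)
      finally show ?thesis by simp
    qed
    have H1: "(\<Sum>m<10. of_nat (cubic_exp v m) * H m ((character m + f) mod 13)) = 0" for f v
    proof -
      have "(\<Sum>j\<in>UNIV. \<phi> (i, j) * (of_nat (cubic_exp v (idx j)) * z ^ (pos i * character (idx j)))) = 0" for i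
      proof -
        have "0 = (\<Sum>j\<in>UNIV. \<Sum>i'\<in>UNIV. \<phi> (i', j) * L (Inr (i, v)) (i', j))"
          using ann[of "Inr (i, v)"] by (subst sum.swap) (simp add: sum.cartesian_product)
        also have "\<dots> = (\<Sum>j\<in>UNIV. \<phi> (i, j) * (of_nat (cubic_exp v (idx j)) * z ^ (pos i * character (idx j))))"
          by (intro sum.cong refl) (simp add: L_def ver if_distrib[of "(*) _"] cong: if_cong)
        finally show ?thesis by simp
      qed
      \<comment> \<open>The point directions give one condition for each \<open>i\<close>; weighting
        them by \<open>z ^ (pos i * f)\<close> and summing expresses them through \<open>H\<close>,
        shifted by \<open>f\<close>.\<close>
      then have "0 = (\<Sum>i\<in>UNIV. z ^ (pos i * f) *
          (\<Sum>j\<in>UNIV. \<phi> (i, j) * (of_nat (cubic_exp v (idx j)) * z ^ (pos i * character (idx j)))))"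
        by simp
      also have "\<dots> = (\<Sum>j\<in>UNIV. \<Sum>i\<in>UNIV. z ^ (pos i * f) *
          (\<phi> (i, j) * (of_nat (cubic_exp v (idx j)) * z ^ (pos i * character (idx j)))))"
        unfolding sum_distrib_left by (rule sum.swap)
      also have "\<dots> = (\<Sum>j\<in>UNIV. of_nat (cubic_exp v (idx j)) * H (idx j) (character (idx j) + f))"
        by (intro sum.cong refl)
          (simp add: H_def ix' sum_distrib_left power_add add_mult_distrib2 mult_ac)
      also have "\<dots> = (\<Sum>m<10. of_nat (cubic_exp v m) * H m (character m + f))"
        by (rule sum.reindex_bij_betw[OF bij_idx])
      finally show ?thesis by (simp add: H_mod)
    qed
    have H: "H m e = 0" if "m < 10" for m e
      using characters_independent[of H m "e mod 13", OF H0 H1 that] by (simp add: H_mod)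
    show "\<forall>k. \<phi> k = 0"
    proof (clarify)
      fix i j
      define \<psi> where "\<psi> n = \<phi> (inv_into UNIV pos n, j)" for n
      have inv: "inv_into UNIV pos (pos i) = i" for i
        using pos by (auto intro!: inv_into_f_f simp: bij_betw_def)
      have "(\<Sum>n<13. \<psi> n * z ^ (n * e)) = 0" for e
      proof -
        have "(\<Sum>n<13. \<psi> n * z ^ (n * e)) = (\<Sum>i\<in>UNIV. \<psi> (pos i) * z ^ (pos i * e))"
          by (rule sum.reindex_bij_betw[OF pos, symmetric])
        also have "\<dots> = H (idx j) e" by (simp add: \<psi>_def inv H_def ix')
        also have "\<dots> = 0" by (intro H idx_less)
        finally show ?thesis .
      qed
      moreover have "pos i < 13" using pos by (auto simp: bij_betw_def)
      ultimately have "\<psi> (pos i) = 0" using fourier_zero[OF z] by blast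
      then show "\<phi> (i, j) = 0" by (simp add: \<psi>_def inv)
    qed
  qed
  have combination: "(\<Sum>p\<in>UNIV. c p * L p (i, j)) = (\<Sum>b\<in>UNIV. c (Inl (j, b)) * cubic_veronese_map (X i) $ b)
      + (\<Sum>v\<in>UNIV. of_nat (cubic_exp v (idx j)) * c (Inr (i, v))) * cubic_veronese_map (X i) $ j" for c i j
  proof -
    have "(\<Sum>p\<in>UNIV. c p * L p (i, j)) = (\<Sum>a\<in>UNIV. \<Sum>b\<in>UNIV. c (Inl (a, b)) * L (Inl (a, b)) (i, j))
        + (\<Sum>i'\<in>UNIV. \<Sum>v\<in>UNIV. c (Inr (i', v)) * L (Inr (i', v)) (i, j))"
      by (simp add: UNIV_Plus_UNIV[symmetric] sum.Plus sum.cartesian_product del: UNIV_Plus_UNIV)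
    also have "(\<Sum>a\<in>UNIV. \<Sum>b\<in>UNIV. c (Inl (a, b)) * L (Inl (a, b)) (i, j))
        = (\<Sum>b\<in>UNIV. c (Inl (j, b)) * cubic_veronese_map (X i) $ b)"
      by (subst sum.swap) (simp add: L_def if_distrib[of "(*) _"] cong: if_cong)
    also have "(\<Sum>i'\<in>UNIV. \<Sum>v\<in>UNIV. c (Inr (i', v)) * L (Inr (i', v)) (i, j))
        = (\<Sum>v\<in>UNIV. c (Inr (i, v)) * (of_nat (cubic_exp v (idx j)) * cubic_veronese_map (X i) $ j))"
      by (subst sum.swap) (simp add: L_def if_distrib[of "(*) _"] cong: if_cong)
    finally show ?thesis by (simp add: sum_distrib_left mult_ac)
  qed
  show ?thesis
  proof (intro exI[of _ X] allI)
    fix \<zeta> :: "13 \<times> 10 \<Rightarrow> 'k"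
    obtain c where "\<forall>k. \<zeta> k = (\<Sum>p\<in>UNIV. c p * L p k)" using surj[of \<zeta>] by (elim exE) (rule that)
    then show "\<exists>(A :: 'k ^ 10 ^ 10) (W :: 13 \<Rightarrow> 3 \<Rightarrow> 'k). \<forall>i j.
      \<zeta> (i, j) = (\<Sum>b\<in>UNIV. A $ j $ b * cubic_veronese_map (X i) $ b)
        + (\<Sum>v\<in>UNIV. of_nat (cubic_exp v (idx j)) * W i v) * cubic_veronese_map (X i) $ j"
      by (intro exI[of _ "\<chi> a b. c (Inl (a, b))"] exI[of _ "\<lambda>i v. c (Inr (i, v))"])
        (simp add: combination)
  qed
qed

section \<open>Configurations on Veronese surfaces\<close>

text \<open>Coordinate vectors are used without passing to proportionality classes, so that
  polynomial conditions in \<open>M\<close> and \<open>X\<close> describe the set before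
  projection.\<close>

definition framed_configurations :: "(13 \<times> 10 \<Rightarrow> 'k::field_char_0) set" where
  "framed_configurations = {u. \<exists>(M :: 'k ^ 10 ^ 10) (X :: 13 \<Rightarrow> 'k ^ 3). det M \<noteq> 0 \<and>
     (\<forall>i j. u (i, j) = (M *v cubic_veronese_map (X i)) $ j)}"

text \<open>The set is the projection of an explicit locus \<open>T\<close> of triples of
  configuration, matrix and points; only finitely many coordinates are forgotten.\<close>

lemma constructible_framed_configurations:
  assumes "alg_closed_field TYPE('k::field_char_0)"
  shows "constructible (framed_configurations :: (13 \<times> 10 \<Rightarrow> 'k) set)"
proof -
  let ?M = "\<lambda>s :: (13 \<times> 10) + ((10 \<times> 10) + (13 \<times> 3)) \<Rightarrow> 'k. (\<chi> a b. s (Inr (Inl (a, b)))) :: 'k ^ 10 ^ 10"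
  let ?X = "\<lambda>(s :: (13 \<times> 10) + ((10 \<times> 10) + (13 \<times> 3)) \<Rightarrow> 'k) i. (\<chi> v. s (Inr (Inr (i, v)))) :: 'k ^ 3"
  define T where "T = {s. det (?M s) \<noteq> 0} \<inter>
    (\<Inter>(i, j)\<in>UNIV. {s. s (Inl (i, j)) - (?M s *v cubic_veronese_map (?X s i)) $ j = 0})"
  have ver: "poly_fun (\<lambda>s. cubic_veronese_map (?X s i) $ b)" for i b
    by (simp add: veronese_component) (intro poly_fun_prod poly_fun_power poly_fun.var)
  have "constructible {s. det (?M s) \<noteq> 0}"
    by (intro constructible_nonzeros poly_fun_det) (simp add: poly_fun.var)
  moreover have "poly_fun (\<lambda>s. s (Inl (i, j)) - (?M s *v cubic_veronese_map (?X s i)) $ j)" for i j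
    unfolding matrix_vector_mult_def
    by (simp, intro poly_fun_diff poly_fun_sum poly_fun.mult poly_fun.var ver)
  then have "constructible {s. s (Inl (i, j)) - (?M s *v cubic_veronese_map (?X s i)) $ j = 0}" for i j
    by (rule constructible.zeros)
  ultimately have "constructible T"
    unfolding T_def by (intro constructible.inter constructible_INT) (simp_all split: prod.split del: right_minus_eq)
  then have "constructible {u. \<exists>w. case_sum u w \<in> T}"
    by (rule constructible_projection[OF assms])
  moreover have "{u. \<exists>w. case_sum u w \<in> T} = framed_configurations"
  proof (intro set_eqI iffI)
    fix u :: "13 \<times> 10 \<Rightarrow> 'k"
    assume "u \<in> {u. \<exists>w. case_sum u w \<in> T}"
    then obtain w where w: "case_sum u w \<in> T" by blast
    then show "u \<in> framed_configurations"
      unfolding framed_configurations_def mem_Collect_eq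
      by (intro exI[of _ "\<chi> a b. w (Inl (a, b))"] exI[of _ "\<lambda>i. \<chi> v. w (Inr (i, v))"])
        (auto simp: T_def)
  next
    fix u :: "13 \<times> 10 \<Rightarrow> 'k"
    assume "u \<in> framed_configurations"
    then obtain M :: "'k ^ 10 ^ 10" and X :: "13 \<Rightarrow> 'k ^ 3"
      where "det M \<noteq> 0" "\<forall>i j. u (i, j) = (M *v cubic_veronese_map (X i)) $ j"
      unfolding framed_configurations_def by blast
    then have "case_sum u (case_sum (\<lambda>(a, b). M $ a $ b) (\<lambda>(i, v). X i $ v)) \<in> T"
      by (auto simp: T_def)
    then show "u \<in> {u. \<exists>w. case_sum u w \<in> T}" by blast
  qed
  ultimately show ?thesis by simp
qed

section \<open>First-order expansion along curves of configurations\<close>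

lemma coeff_mult_Suc_0:
  "coeff (p * q) (Suc 0) = coeff p 0 * coeff q (Suc 0) + coeff p (Suc 0) * coeff q 0"
  by (simp add: coeff_mult)

lemma coeff_linear_power:
  fixes w :: "'k::comm_ring_1"
  shows "coeff ([:1, w:] ^ n) 0 = 1" "coeff ([:1, w:] ^ n) (Suc 0) = of_nat n * w"
proof -
  show 0: "coeff ([:1, w:] ^ n) 0 = 1" for n
    by (induction n) (simp_all add: coeff_mult_0 coeff_mult_Suc_0 del: mult_pCons_left mult_pCons_right)
  show "coeff ([:1, w:] ^ n) (Suc 0) = of_nat n * w"
    by (induction n) (simp_all add: coeff_mult_0 coeff_mult_Suc_0 0 algebra_simps del: mult_pCons_left mult_pCons_right)
qed

text \<open>Moving the matrix as \<open>1 + t A\<close> and each coordinate as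
  \<open>X (1 + t W)\<close> realizes every tangent vector by a polynomial curve, which stays in the
  set except for the finitely many \<open>t\<close> where the matrix is singular.\<close>

lemma framed_configurations_dense:
  fixes G :: "(13 \<times> 10 \<Rightarrow> 'k::field_char_0) \<Rightarrow> 'k"
  assumes "alg_closed_field TYPE('k)" "poly_fun G"
    and "\<And>u. u \<in> framed_configurations \<Longrightarrow> G u = 0"
  shows "G u = 0"
proof -
  obtain X :: "13 \<Rightarrow> 'k ^ 3" where X: "\<forall>\<zeta> :: 13 \<times> 10 \<Rightarrow> 'k. \<exists>(A :: 'k ^ 10 ^ 10) (W :: 13 \<Rightarrow> 3 \<Rightarrow> 'k). \<forall>i j.
    \<zeta> (i, j) = (\<Sum>b\<in>UNIV. A $ j $ b * cubic_veronese_map (X i) $ b)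
      + (\<Sum>v\<in>UNIV. of_nat (cubic_exp v (idx j)) * W i v) * cubic_veronese_map (X i) $ j"
    using tangent_map_surjective[OF assms(1)] by (elim exE) (rule that)
  show ?thesis
  proof (rule dense_if_curves[OF assms(2), where y = "\<lambda>(i, j). cubic_veronese_map (X i) $ j"])
    fix \<zeta> :: "13 \<times> 10 \<Rightarrow> 'k"
    obtain A :: "'k ^ 10 ^ 10" and W :: "13 \<Rightarrow> 3 \<Rightarrow> 'k" where AW: "\<forall>i j.
      \<zeta> (i, j) = (\<Sum>b\<in>UNIV. A $ j $ b * cubic_veronese_map (X i) $ b)
        + (\<Sum>v\<in>UNIV. of_nat (cubic_exp v (idx j)) * W i v) * cubic_veronese_map (X i) $ j"
      using X[rule_format, of \<zeta>] by (elim exE) (rule that)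
    \<comment> \<open>The monomial with index \<open>j\<close> along the moving point
      \<open>Y i t\<close>, as a polynomial in \<open>t\<close>.\<close>
    define N where "N i j = smult (cubic_veronese_map (X i) $ j)
      (\<Prod>v\<in>UNIV. [:1, W i v:] ^ cubic_exp v (idx j))" for i j
    define P where "P = (\<lambda>(i, j). N i j + pCons 0 (\<Sum>b\<in>UNIV. smult (A $ j $ b) (N i b)))"
    define M where "M t = (\<chi> a b. (if a = b then 1 else 0) + t * A $ a $ b)" for t
    define Y where "Y i t = (\<chi> v. X i $ v * (1 + t * W i v))" for i t
    have N: "poly (N i j) t = cubic_veronese_map (Y i t) $ j" for i j t
      by (simp add: N_def veronese_component Y_def poly_prod power_mult_distrib prod.distrib)
    have P: "poly (P (i, j)) t = (M t *v cubic_veronese_map (Y i t)) $ j" for i j t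
    proof -
      have "(M t *v cubic_veronese_map (Y i t)) $ j
          = (\<Sum>b\<in>UNIV. (if j = b then cubic_veronese_map (Y i t) $ b else 0)
              + t * (A $ j $ b * cubic_veronese_map (Y i t) $ b))"
        unfolding matrix_vector_mult_def M_def by (simp, intro sum.cong refl) (simp add: distrib_right)
      then show ?thesis by (simp add: P_def N poly_sum sum.distrib sum_distrib_left)
    qed
    have N0: "coeff (N i j) 0 = cubic_veronese_map (X i) $ j" for i j
      by (simp add: N_def prod_index_3 coeff_mult_0 coeff_mult_Suc_0 coeff_linear_power)
    have N1: "coeff (N i j) 1 = (\<Sum>v\<in>UNIV. of_nat (cubic_exp v (idx j)) * W i v) * cubic_veronese_map (X i) $ j" for i j
      by (simp add: N_def prod_index_3 sum_index_3 coeff_mult_0 coeff_mult_Suc_0 coeff_linear_power algebra_simps)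
    have "coeff (P k) 0 = (\<lambda>(i, j). cubic_veronese_map (X i) $ j) k" for k
      by (cases k) (simp add: P_def N0)
    moreover have "coeff (P k) 1 = \<zeta> k" for k
    proof (cases k)
      case (Pair i j)
      then show ?thesis using AW[rule_format, of i j] N1[of i j] by (simp add: P_def coeff_sum N0)
    qed
    moreover have "finite {t. G (\<lambda>k. poly (P k) t) \<noteq> 0}"
    proof -
      \<comment> \<open>The determinant of \<open>M t\<close> is a polynomial \<open>D\<close> in
        \<open>t\<close> with value 1 at 0, hence with finitely many roots.\<close>
      have fam: "poly_fun (\<lambda>x. det (\<chi> a b. x (a, b)) :: 'k)"
        by (intro poly_fun_det) (simp add: poly_fun.var)
      obtain D where D: "\<And>t. det (\<chi> a b. poly ((\<lambda>(a, b). [:if a = b then 1 else 0, A $ a $ b:]) (a, b)) t) = poly D t"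
        using poly_fun_curve[OF fam, of "\<lambda>(a, b). [:if a = b then 1 else 0, A $ a $ b:]"] by blast
      have det: "det (M t) = poly D t" for t
        using D[of t] by (simp add: M_def mult.commute)
      have "M 0 = mat 1" by (simp add: M_def mat_def)
      then have "D \<noteq> 0" using det[of 0] by auto
      moreover have "{t. G (\<lambda>k. poly (P k) t) \<noteq> 0} \<subseteq> {t. poly D t = 0}"
      proof clarify
        fix t assume G: "G (\<lambda>k. poly (P k) t) \<noteq> 0"
        show "poly D t = 0"
        proof (rule ccontr)
          assume "poly D t \<noteq> 0"
          then have "(\<lambda>k. poly (P k) t) \<in> framed_configurations"
            unfolding framed_configurations_def mem_Collect_eq
            using det P by (intro exI[of _ "M t"] exI[of _ "\<lambda>i. Y i t"]) simp
          with assms(3) G show False by blast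
        qed
      qed
      ultimately show ?thesis using poly_roots_finite finite_subset by blast
    qed
    ultimately show "\<exists>P. (\<forall>k. coeff (P k) 0 = (\<lambda>(i, j). cubic_veronese_map (X i) $ j) k \<and> coeff (P k) 1 = \<zeta> k)
        \<and> finite {t. G (\<lambda>k. poly (P k) t) \<noteq> 0}"
      by blast
  qed
qed

text \<open>Generality means lying off the zero set of a nonzero polynomial \<open>F\<close> in all
  130 homogeneous coordinates. The dichotomy for constructible sets supplies \<open>F\<close>, and
  density selects the right alternative.\<close>

theorem theorem6p1:
  fixes K :: "'k::field_char_0 itself"
  assumes "alg_closed_field K"
  shows "\<exists>F :: (13 \<times> 10 \<Rightarrow> 'k) \<Rightarrow> 'k. poly_fun F \<and> (\<exists>y. F y \<noteq> 0) \<and>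
           (\<forall>P :: 'k ^ 10 ^ 13.
              (\<forall>i. P $ i \<noteq> 0) \<and> F (\<lambda>(i, j). P $ i $ j) \<noteq> 0 \<longrightarrow>
              (\<exists>M :: 'k ^ 10 ^ 10. invertible M \<and> (\<forall>i. on_veronese_surface M (P $ i))))"
proof -
  have ac: "alg_closed_field TYPE('k)"
    using assms by (simp add: alg_closed_field_def)
  obtain F :: "(13 \<times> 10 \<Rightarrow> 'k) \<Rightarrow> 'k" where F: "poly_fun F" "\<exists>y. F y \<noteq> 0"
    and dich: "(\<forall>v. F v \<noteq> 0 \<longrightarrow> v \<in> framed_configurations) \<or> (\<forall>v. F v \<noteq> 0 \<longrightarrow> v \<notin> framed_configurations)"
    using constructible_dichotomy[OF constructible_framed_configurations[OF ac]] by blast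
  \<comment> \<open>Otherwise \<open>F\<close> would vanish on all framed configurations, hence
    everywhere by density.\<close>
  have "\<not> (\<forall>v. F v \<noteq> 0 \<longrightarrow> v \<notin> framed_configurations)"
    using framed_configurations_dense[OF ac F(1)] F(2) by blast
  with dich have F': "\<And>v. F v \<noteq> 0 \<Longrightarrow> v \<in> framed_configurations" by blast
  have "\<exists>M :: 'k ^ 10 ^ 10. invertible M \<and> (\<forall>i. on_veronese_surface M (P $ i))"
    if nz: "\<forall>i. P $ i \<noteq> 0" and FP: "F (\<lambda>(i, j). P $ i $ j) \<noteq> 0" for P :: "'k ^ 10 ^ 13"
  proof -
    obtain M :: "'k ^ 10 ^ 10" and X :: "13 \<Rightarrow> 'k ^ 3" where M: "det M \<noteq> 0"
      and eq: "\<forall>i j. P $ i $ j = (M *v cubic_veronese_map (X i)) $ j"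
      using F'[OF FP] unfolding framed_configurations_def by auto
    have P: "P $ i = M *v cubic_veronese_map (X i)" for i
      using eq by (simp add: vec_eq_iff)
    \<comment> \<open>Framed configurations allow the zero vector as a parameter; its image is zero,
      which the nonzero coordinate vector \<open>P $ i\<close> excludes.\<close>
    have "X i \<noteq> 0" for i
    proof
      assume "X i = 0"
      have "cubic_monomials (0 :: 'k ^ 3) = replicate 10 0"
        by (simp add: cubic_monomials_def Let_def eval_nat_numeral)
      then have "cubic_veronese_map (0 :: 'k ^ 3) = 0"
        using idx_less by (simp add: cubic_veronese_map_def vec_eq_iff)
      with \<open>X i = 0\<close> P[of i] nz show False by (simp add: matrix_vector_mult_0_right)
    qed
    then have "on_veronese_surface M (P $ i)" for i
      unfolding on_veronese_surface_def using P[of i]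
      by (intro exI[of _ "X i"] conjI exI[of _ 1]) simp_all
    moreover have "invertible M" using M by (simp add: invertible_det_nz)
    ultimately show ?thesis by blast
  qed
  then show ?thesis using F by blast
qed

end
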